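(* Let $X$ be a connected complex manifold with $\dim_{\mathbb{C}}X=1$. Let $V\subset\mathcal{O}(X)$ be an infinite-dimensional quasi-Banach space with continuous inclusion. Let $f:X\to X$ be holomorphic and let $u\in\mathcal{O}(X)\setminus\{0\}$. Assume that $uC_f$ is bounded on $V$. Then for every fixed point $p\in X$ of $f$, one has $|f'(p)|\le1$.
   Context: $\mathcal{O}(X)$ is the space of holomorphic functions on $X$ with the topology of uniform convergence on compact sets. A quasi-Banach space is a complete Hausdorff topological vector space whose topology is given by a quasi-norm: a map $\|\cdot\|_V:V\to\mathbb{R}_{\ge0}$ with $\|av\|_V=|a|\|v\|_V$, $\|v+w\|_V\le K(\|v\|_V+\|w\|_V)$ for some $K\ge1$ independent of $v,w$, and $\|v\|_V=0\Rightarrow v=0$. "$V\subset\mathcal{O}(X)$ with continuous inclusion" means $V$ is a complex linear subspace of $\mathcal{O}(X)$, with its own topology, such that the inclusion $V\hookrightarrow\mathcal{O}(X)$ is continuous. The weighted composition operator $uC_f$ on $V$ is $h\mapsto u\cdot(h\circ f)$ with domain $\{h\in V:u\cdot(h\circ f)\in V\}$; it is bounded on $V$ if its domain is all of $V$ and it is a bounded operator $V\to V$. At a fixed point $p$, $f'(p)$ denotes the derivative of $f$ at $p$ in a local coordinate around $p$ (independent of the coordinate), i.e. the scalar by which $\mathrm{d}f_p$ acts on the one-dimensional space $T_p^{1,0}X$. *)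

theory Defs
  imports "HOL-Complex_Analysis.Complex_Analysis" "HOL-Library.Function_Algebras"
begin

section \<open>Riemann surfaces\<close>

type_synonym 'a chart = "'a set \<times> ('a \<Rightarrow> complex)"

definition is_chart :: "'a topology \<Rightarrow> 'a chart \<Rightarrow> bool" where
  "is_chart X = (\<lambda>(U, \<phi>). openin X U \<and> open (\<phi> ` U) \<and>
     homeomorphic_map (subtopology X U) (top_of_set (\<phi> ` U)) \<phi>)"

locale riemann_surface =
  fixes X :: "'a topology" and A :: "'a chart set"
  assumes Hausdorff: "Hausdorff_space X"
    and second_countable: "second_countable X"
    and connected: "connected_space X"
    and charts: "\<And>c. c \<in> A \<Longrightarrow> is_chart X c"
    and cover: "(\<Union>(U, \<phi>)\<in>A. U) = topspace X"
    and compatible: "\<And>U \<phi> W \<psi>. (U, \<phi>) \<in> A \<Longrightarrow> (W, \<psi>) \<in> A \<Longrightarrow>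
          (\<psi> \<circ> inv_into U \<phi>) holomorphic_on \<phi> ` (U \<inter> W)"

text \<open>A holomorphic function on \<open>X\<close> is represented by its extension by zero to the whole
  ambient type, so that equality of functions and the pointwise operations on
  \<^typ>\<open>'a \<Rightarrow> complex\<close> agree with those of functions on \<open>X\<close>.\<close>

definition hol_funs :: "'a topology \<Rightarrow> 'a chart set \<Rightarrow> ('a \<Rightarrow> complex) set" where
  "hol_funs X A = {h. (\<forall>(U, \<phi>)\<in>A. (h \<circ> inv_into U \<phi>) holomorphic_on \<phi> ` U) \<and>
                      (\<forall>x. x \<notin> topspace X \<longrightarrow> h x = 0)}"

definition hol_self_map :: "'a topology \<Rightarrow> 'a chart set \<Rightarrow> ('a \<Rightarrow> 'a) \<Rightarrow> bool" where
  "hol_self_map X A f \<longleftrightarrow> continuous_map X X f \<and>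
     (\<forall>(U, \<phi>)\<in>A. \<forall>(W, \<psi>)\<in>A. (\<psi> \<circ> f \<circ> inv_into U \<phi>) holomorphic_on \<phi> ` (U \<inter> f -` W))"

definition chart_deriv :: "'a chart \<Rightarrow> ('a \<Rightarrow> 'a) \<Rightarrow> 'a \<Rightarrow> complex" where
  "chart_deriv = (\<lambda>(U, \<phi>) f p. deriv (\<phi> \<circ> f \<circ> inv_into U \<phi>) (\<phi> p))"

text \<open>The derivative at a fixed point; by \<open>fixpoint_deriv_eq\<close> below it may be computed in
  any chart around the point.\<close>

definition fixpoint_deriv :: "'a chart set \<Rightarrow> ('a \<Rightarrow> 'a) \<Rightarrow> 'a \<Rightarrow> complex" where
  "fixpoint_deriv A f p = chart_deriv (SOME c. c \<in> A \<and> p \<in> fst c) f p"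

lemma chart_deriv_unique:
  assumes "riemann_surface X A" and f: "hol_self_map X A f"
    and c: "(U, \<phi>) \<in> A" "p \<in> U" and d: "(W, \<psi>) \<in> A" "p \<in> W" and fp: "f p = p"
  shows "chart_deriv (U, \<phi>) f p = chart_deriv (W, \<psi>) f p"
proof -
  interpret riemann_surface X A by fact
  have cc: "openin X U" "open (\<phi> ` U)" "homeomorphic_map (subtopology X U) (top_of_set (\<phi> ` U)) \<phi>"
    and dd: "openin X W" "open (\<psi> ` W)" "homeomorphic_map (subtopology X W) (top_of_set (\<psi> ` W)) \<psi>"
    using charts[OF c(1)] charts[OF d(1)] by (auto simp: is_chart_def)
  have inj1: "inj_on \<phi> U" and inj2: "inj_on \<psi> W"
    using homeomorphic_imp_injective_map[OF cc(3)] homeomorphic_imp_injective_map[OF dd(3)]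
      openin_subset[OF cc(1)] openin_subset[OF dd(1)]
    by (auto simp: Int_absorb1)
  have open_im1: "open (\<phi> ` T)" if "openin X T" "T \<subseteq> U" for T
  proof -
    have "openin (subtopology X U) T" using that by (auto simp: openin_subtopology)
    then have "openin (top_of_set (\<phi> ` U)) (\<phi> ` T)"
      using homeomorphic_imp_open_map[OF cc(3)] by (auto simp: open_map_def)
    then show ?thesis using cc(2) openin_open_trans by blast
  qed
  have open_im2: "open (\<psi> ` T)" if "openin X T" "T \<subseteq> W" for T
  proof -
    have "openin (subtopology X W) T" using that by (auto simp: openin_subtopology)
    then have "openin (top_of_set (\<psi> ` W)) (\<psi> ` T)"
      using homeomorphic_imp_open_map[OF dd(3)] by (auto simp: open_map_def)
    then show ?thesis using dd(2) openin_open_trans by blast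
  qed
  have cont: "continuous_map X X f" using f by (simp add: hol_self_map_def)
  define S where "S = {x \<in> topspace X. f x \<in> U \<inter> W} \<inter> (U \<inter> W)"
  have S: "openin X S"
    unfolding S_def using cc(1) dd(1) cont
    by (intro openin_Int openin_continuous_map_preimage) auto
  have fS: "f x \<in> U" "f x \<in> W" if "x \<in> S" for x
    using that by (auto simp: S_def)
  have SS: "S \<subseteq> U" "S \<subseteq> W" by (auto simp: S_def)
  have pS: "p \<in> S" using c d fp openin_subset[OF cc(1)] by (auto simp: S_def)
  define g where "g = \<psi> \<circ> inv_into U \<phi>"
  define k where "k = \<phi> \<circ> inv_into W \<psi>"
  define F where "F = \<phi> \<circ> f \<circ> inv_into U \<phi>"
  define G where "G = \<psi> \<circ> f \<circ> inv_into W \<psi>"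
  have oUW: "openin X (U \<inter> W)" using cc(1) dd(1) by blast
  have g: "(g has_field_derivative deriv g (\<phi> p)) (at (\<phi> p))"
  proof (rule holomorphic_derivI)
    show "g holomorphic_on \<phi> ` (U \<inter> W)" unfolding g_def by (rule compatible) fact+
    show "open (\<phi> ` (U \<inter> W))" by (rule open_im1[OF oUW]) auto
    show "\<phi> p \<in> \<phi> ` (U \<inter> W)" using c d by auto
  qed
  have k: "(k has_field_derivative deriv k (\<psi> p)) (at (\<psi> p))"
  proof (rule holomorphic_derivI)
    show "k holomorphic_on \<psi> ` (W \<inter> U)" unfolding k_def by (rule compatible) fact+
    show "open (\<psi> ` (W \<inter> U))" by (rule open_im2) (use oUW in \<open>auto simp: Int_commute\<close>)
    show "\<psi> p \<in> \<psi> ` (W \<inter> U)" using c d by auto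
  qed
  have F: "(F has_field_derivative deriv F (\<phi> p)) (at (\<phi> p))"
  proof (rule holomorphic_derivI)
    have "F holomorphic_on \<phi> ` (U \<inter> f -` U)"
      unfolding F_def using f c(1) by (auto simp: hol_self_map_def)
    then show "F holomorphic_on \<phi> ` S"
      by (rule holomorphic_on_subset) (auto simp: S_def)
    show "open (\<phi> ` S)" by (rule open_im1[OF S SS(1)])
    show "\<phi> p \<in> \<phi> ` S" using pS by auto
  qed
  have kp: "k (\<psi> p) = \<phi> p" using inj2 d by (simp add: k_def)
  have Fp: "F (\<phi> p) = \<phi> p" using inj1 c fp by (simp add: F_def)
  have gp: "g (\<phi> p) = \<psi> p" using inj1 c by (simp add: g_def)
  have oS: "open (\<psi> ` S)" by (rule open_im2[OF S SS(2)])
  have "((\<lambda>z. g (k z)) has_field_derivative deriv g (\<phi> p) * deriv k (\<psi> p)) (at (\<psi> p))"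
    using DERIV_chain2[of g "deriv g (\<phi> p)" k "\<psi> p"] g k kp by simp
  then have "((\<lambda>z. z) has_field_derivative deriv g (\<phi> p) * deriv k (\<psi> p)) (at (\<psi> p))"
  proof (rule has_field_derivative_transform_within_open[OF _ oS])
    fix z assume "z \<in> \<psi> ` S"
    then show "g (k z) = z" using inj1 inj2 SS by (auto simp: g_def k_def inv_into_f_f subset_iff)
  qed (use pS in auto)
  then have one: "deriv g (\<phi> p) * deriv k (\<psi> p) = 1"
    using DERIV_ident DERIV_unique by blast
  have "((\<lambda>z. F (k z)) has_field_derivative deriv F (\<phi> p) * deriv k (\<psi> p)) (at (\<psi> p))"
    using DERIV_chain2[of F "deriv F (\<phi> p)" k "\<psi> p"] F k kp by simp
  then have "((\<lambda>z. g (F (k z))) has_field_derivative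
      deriv g (\<phi> p) * (deriv F (\<phi> p) * deriv k (\<psi> p))) (at (\<psi> p))"
    using DERIV_chain2[of g "deriv g (\<phi> p)" "\<lambda>z. F (k z)" "\<psi> p"] g kp Fp by simp
  then have "(G has_field_derivative
      deriv g (\<phi> p) * (deriv F (\<phi> p) * deriv k (\<psi> p))) (at (\<psi> p))"
  proof (rule has_field_derivative_transform_within_open[OF _ oS])
    fix z assume "z \<in> \<psi> ` S"
    then obtain x where x: "x \<in> S" "z = \<psi> x" by auto
    then have "x \<in> U" "x \<in> W" "f x \<in> U" using SS fS by auto
    then show "g (F (k z)) = G z"
      using inj1 inj2 x by (simp add: g_def k_def F_def G_def)
  qed (use pS in auto)
  then have "deriv G (\<psi> p) = deriv g (\<phi> p) * (deriv F (\<phi> p) * deriv k (\<psi> p))"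
    by (rule DERIV_imp_deriv)
  also have "\<dots> = (deriv g (\<phi> p) * deriv k (\<psi> p)) * deriv F (\<phi> p)" by (simp add: ac_simps)
  also have "\<dots> = deriv F (\<phi> p)" by (simp add: one)
  finally show ?thesis by (simp add: chart_deriv_def F_def G_def)
qed

lemma fixpoint_deriv_eq:
  assumes "riemann_surface X A" "hol_self_map X A f" "(U, \<phi>) \<in> A" "p \<in> U" "f p = p"
  shows "fixpoint_deriv A f p = deriv (\<phi> \<circ> f \<circ> inv_into U \<phi>) (\<phi> p)"
proof -
  obtain W \<psi> where c: "(SOME c. c \<in> A \<and> p \<in> fst c) = (W, \<psi>)" by force
  have "(SOME c. c \<in> A \<and> p \<in> fst c) \<in> A \<and> p \<in> fst (SOME c. c \<in> A \<and> p \<in> fst c)"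
    by (rule someI[of _ "(U, \<phi>)"]) (use assms in auto)
  then have "(W, \<psi>) \<in> A" "p \<in> W" by (auto simp: c)
  from chart_deriv_unique[OF assms(1,2) this assms(3-5)] show ?thesis
    by (simp add: fixpoint_deriv_def c chart_deriv_def)
qed

section \<open>The topology of uniform convergence on compact sets\<close>

definition hol_topology :: "'a topology \<Rightarrow> 'a chart set \<Rightarrow> ('a \<Rightarrow> complex) topology" where
  "hol_topology X A = topology (\<lambda>\<U>. \<U> \<subseteq> hol_funs X A \<and>
     (\<forall>h\<in>\<U>. \<exists>K \<epsilon>. compactin X K \<and> \<epsilon> > 0 \<and>
        (\<forall>g\<in>hol_funs X A. (\<forall>x\<in>K. cmod (g x - h x) < \<epsilon>) \<longrightarrow> g \<in> \<U>)))"

lemma openin_hol_topology: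
  "openin (hol_topology X A) \<U> \<longleftrightarrow> \<U> \<subseteq> hol_funs X A \<and>
     (\<forall>h\<in>\<U>. \<exists>K \<epsilon>. compactin X K \<and> \<epsilon> > 0 \<and>
        (\<forall>g\<in>hol_funs X A. (\<forall>x\<in>K. cmod (g x - h x) < \<epsilon>) \<longrightarrow> g \<in> \<U>))"
proof -
  let ?P = "\<lambda>\<U>. \<U> \<subseteq> hol_funs X A \<and> (\<forall>h\<in>\<U>. \<exists>K \<epsilon>. compactin X K \<and> \<epsilon> > 0 \<and>
        (\<forall>g\<in>hol_funs X A. (\<forall>x\<in>K. cmod (g x - h x) < \<epsilon>) \<longrightarrow> g \<in> \<U>))"
  have "istopology ?P"
    unfolding istopology_def
  proof (intro conjI allI impI)
    fix S T assume S: "?P S" and T: "?P T"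
    show "S \<inter> T \<subseteq> hol_funs X A" using S by blast
    show "\<forall>h\<in>S \<inter> T. \<exists>K \<epsilon>. compactin X K \<and> \<epsilon> > 0 \<and>
        (\<forall>g\<in>hol_funs X A. (\<forall>x\<in>K. cmod (g x - h x) < \<epsilon>) \<longrightarrow> g \<in> S \<inter> T)"
    proof
      fix h assume "h \<in> S \<inter> T"
      then obtain K1 e1 K2 e2 where
        1: "compactin X K1" "e1 > 0" "\<forall>g\<in>hol_funs X A. (\<forall>x\<in>K1. cmod (g x - h x) < e1) \<longrightarrow> g \<in> S" and
        2: "compactin X K2" "e2 > 0" "\<forall>g\<in>hol_funs X A. (\<forall>x\<in>K2. cmod (g x - h x) < e2) \<longrightarrow> g \<in> T"
        using S T by (metis IntE)
      show "\<exists>K \<epsilon>. compactin X K \<and> \<epsilon> > 0 \<and>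
        (\<forall>g\<in>hol_funs X A. (\<forall>x\<in>K. cmod (g x - h x) < \<epsilon>) \<longrightarrow> g \<in> S \<inter> T)"
        by (rule exI[of _ "K1 \<union> K2"], rule exI[of _ "min e1 e2"])
           (use 1 2 in \<open>auto intro: compactin_Un\<close>)
    qed
  next
    fix \<K> assume K: "\<forall>S\<in>\<K>. ?P S"
    show "\<Union>\<K> \<subseteq> hol_funs X A" using K by blast
    show "\<forall>h\<in>\<Union>\<K>. \<exists>K \<epsilon>. compactin X K \<and> \<epsilon> > 0 \<and>
        (\<forall>g\<in>hol_funs X A. (\<forall>x\<in>K. cmod (g x - h x) < \<epsilon>) \<longrightarrow> g \<in> \<Union>\<K>)"
      using K by (meson UnionE UnionI)
  qed
  then show ?thesis
    by (simp add: hol_topology_def topology_inverse')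
qed

section \<open>Quasi-Banach spaces of functions\<close>

interpretation fun_vs: vector_space "\<lambda>(c::complex) (h::'a \<Rightarrow> complex) x. c * h x"
  by unfold_locales (auto simp: fun_eq_iff algebra_simps)

definition quasi_norm_on :: "('a \<Rightarrow> complex) set \<Rightarrow> (('a \<Rightarrow> complex) \<Rightarrow> real) \<Rightarrow> bool" where
  "quasi_norm_on V N \<longleftrightarrow>
     (\<forall>v\<in>V. N v \<ge> 0) \<and>
     (\<forall>a. \<forall>v\<in>V. N (\<lambda>x. a * v x) = cmod a * N v) \<and>
     (\<exists>K\<ge>1. \<forall>v\<in>V. \<forall>w\<in>V. N (v + w) \<le> K * (N v + N w)) \<and>
     (\<forall>v\<in>V. N v = 0 \<longrightarrow> v = 0)"

definition quasi_banach_on :: "('a \<Rightarrow> complex) set \<Rightarrow> (('a \<Rightarrow> complex) \<Rightarrow> real) \<Rightarrow> bool" where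
  "quasi_banach_on V N \<longleftrightarrow> fun_vs.subspace V \<and> quasi_norm_on V N \<and>
     (\<forall>s :: nat \<Rightarrow> 'a \<Rightarrow> complex. range s \<subseteq> V \<and>
        (\<forall>\<epsilon>>0. \<exists>M. \<forall>m\<ge>M. \<forall>n\<ge>M. N (s m - s n) < \<epsilon>) \<longrightarrow>
        (\<exists>v\<in>V. (\<lambda>n. N (s n - v)) \<longlonglongrightarrow> 0))"

text \<open>Balls of a quasi-norm need not be open; they only form neighbourhood bases.\<close>

definition quasi_norm_topology ::
    "('a \<Rightarrow> complex) set \<Rightarrow> (('a \<Rightarrow> complex) \<Rightarrow> real) \<Rightarrow> ('a \<Rightarrow> complex) topology" where
  "quasi_norm_topology V N = topology (\<lambda>\<U>. \<U> \<subseteq> V \<and>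
     (\<forall>v\<in>\<U>. \<exists>\<epsilon>>0. \<forall>w\<in>V. N (w - v) < \<epsilon> \<longrightarrow> w \<in> \<U>))"

lemma openin_quasi_norm_topology:
  "openin (quasi_norm_topology V N) \<U> \<longleftrightarrow> \<U> \<subseteq> V \<and>
     (\<forall>v\<in>\<U>. \<exists>\<epsilon>>0. \<forall>w\<in>V. N (w - v) < \<epsilon> \<longrightarrow> w \<in> \<U>)"
proof -
  let ?P = "\<lambda>\<U>. \<U> \<subseteq> V \<and> (\<forall>v\<in>\<U>. \<exists>\<epsilon>>0. \<forall>w\<in>V. N (w - v) < \<epsilon> \<longrightarrow> w \<in> \<U>)"
  have "istopology ?P"
    unfolding istopology_def
  proof (intro conjI allI impI)
    fix S T assume S: "?P S" and T: "?P T"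
    show "S \<inter> T \<subseteq> V" using S by blast
    show "\<forall>v\<in>S \<inter> T. \<exists>\<epsilon>>0. \<forall>w\<in>V. N (w - v) < \<epsilon> \<longrightarrow> w \<in> S \<inter> T"
    proof
      fix v assume "v \<in> S \<inter> T"
      then obtain e1 e2 where "e1 > 0" "\<forall>w\<in>V. N (w - v) < e1 \<longrightarrow> w \<in> S"
          "e2 > 0" "\<forall>w\<in>V. N (w - v) < e2 \<longrightarrow> w \<in> T"
        using S T by (metis IntE)
      then show "\<exists>\<epsilon>>0. \<forall>w\<in>V. N (w - v) < \<epsilon> \<longrightarrow> w \<in> S \<inter> T"
        by (intro exI[of _ "min e1 e2"]) auto
    qed
  next
    fix \<K> assume K: "\<forall>S\<in>\<K>. ?P S"
    show "\<Union>\<K> \<subseteq> V" using K by blast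
    show "\<forall>v\<in>\<Union>\<K>. \<exists>\<epsilon>>0. \<forall>w\<in>V. N (w - v) < \<epsilon> \<longrightarrow> w \<in> \<Union>\<K>"
      using K by (meson UnionE UnionI)
  qed
  then show ?thesis
    by (simp add: quasi_norm_topology_def topology_inverse')
qed

definition infinite_dimensional :: "('a \<Rightarrow> complex) set \<Rightarrow> bool" where
  "infinite_dimensional V \<longleftrightarrow> \<not> (\<exists>B. finite B \<and> B \<subseteq> V \<and> V \<subseteq> fun_vs.span B)"

section \<open>Weighted composition operators\<close>

definition wcomp :: "('a \<Rightarrow> complex) \<Rightarrow> ('a \<Rightarrow> 'a) \<Rightarrow> ('a \<Rightarrow> complex) \<Rightarrow> 'a \<Rightarrow> complex" where
  "wcomp u f h = (\<lambda>x. u x * h (f x))"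

definition wcomp_domain ::
    "('a \<Rightarrow> complex) set \<Rightarrow> ('a \<Rightarrow> complex) \<Rightarrow> ('a \<Rightarrow> 'a) \<Rightarrow> ('a \<Rightarrow> complex) set" where
  "wcomp_domain V u f = {h \<in> V. wcomp u f h \<in> V}"

definition wcomp_bounded_on ::
    "('a \<Rightarrow> complex) set \<Rightarrow> (('a \<Rightarrow> complex) \<Rightarrow> real) \<Rightarrow> ('a \<Rightarrow> complex) \<Rightarrow> ('a \<Rightarrow> 'a) \<Rightarrow> bool" where
  "wcomp_bounded_on V N u f \<longleftrightarrow> wcomp_domain V u f = V \<and>
     (\<exists>C. \<forall>h\<in>V. N (wcomp u f h) \<le> C * N h)"

end

theory Submission
  imports Defs
begin

text \<open>
  Write \<open>T = u C\<^sub>f\<close>, let \<open>p\<close> be a fixed point with \<open>\<lambda> = f'(p)\<close>, and work in a chart that sends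
  \<open>p\<close> to \<open>c\<close>. Suppose \<open>|\<lambda>| > 1\<close>. Near \<open>c\<close>, \<open>u\<close> has a leading term \<open>b (z - c)\<^sup>m\<close> with \<open>b \<noteq> 0\<close>, so
  \<open>T\<close> maps a function with leading term \<open>\<beta> (z - c)\<^sup>k\<close> to one with leading term
  \<open>b \<lambda>\<^sup>k \<beta> (z - c)\<^sup>k\<^sup>+\<^sup>m\<close> (lemma \<open>wcomp_leading_term\<close>). Hence if \<open>h \<in> V\<close> has leading term
  \<open>\<alpha> (z - c)\<^sup>d\<close>, then the \<open>n\<close>-th iterate \<open>T\<^sup>n h\<close> has order \<open>d + n m\<close> and a leading coefficient of
  modulus at least \<open>|\<alpha>| (|b| |\<lambda>|\<^sup>d)\<^sup>n\<close>.

  On the other hand, continuity of the inclusion gives \<open>|g| \<le> M N(g)\<close> on a closed disc of radius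
  \<open>R\<close> around \<open>c\<close> for all \<open>g \<in> V\<close> (lemma \<open>evaluation_bound\<close>), so by Cauchy's estimate a leading
  coefficient of order \<open>k\<close> is at most \<open>M N(g) / R\<^sup>k\<close>. With \<open>N(T\<^sup>n h) \<le> C\<^sup>n N(h)\<close> this yields
  \<open>|\<alpha>| R\<^sup>d q\<^sup>n \<le> M N(h)\<close> for all \<open>n\<close>, where \<open>q = |b| |\<lambda>|\<^sup>d R\<^sup>m / C\<close>, which is impossible once
  \<open>q > 1\<close>. As \<open>|\<lambda>| > 1\<close>, it suffices to choose \<open>d\<close> large. Here the dimension of \<open>V\<close> enters: the
  conditions on \<open>h\<close> to vanish to order \<open>n\<close> at \<open>p\<close> are finitely many linear equations, so they
  have a nonzero solution in \<open>V\<close>, and by the identity theorem on the connected surface this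
  solution has a finite order \<open>d \<ge> n\<close> at \<open>p\<close> (lemma \<open>element_of_high_order\<close>).
\<close>

section \<open>Subspaces of finite codimension\<close>

text \<open>If \<open>L w \<noteq> 0\<close>, every \<open>v\<close> differs from an element of the kernel of \<open>L\<close> by a multiple of \<open>w\<close>,
  so a finite spanning set of the kernel together with \<open>w\<close> would span \<open>V\<close>.\<close>

lemma infinite_dimensional_kernel:
  fixes L :: "('a \<Rightarrow> complex) \<Rightarrow> complex"
  assumes V: "fun_vs.subspace V" "infinite_dimensional V"
    and add: "\<And>v w. v \<in> V \<Longrightarrow> w \<in> V \<Longrightarrow> L (v + w) = L v + L w"
    and scale: "\<And>a v. v \<in> V \<Longrightarrow> L (\<lambda>x. a * v x) = a * L v"
  shows "fun_vs.subspace {v \<in> V. L v = 0}" "infinite_dimensional {v \<in> V. L v = 0}"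
proof -
  have zero: "L 0 = 0"
    using scale[of 0 0] fun_vs.subspace_0[OF V(1)] by (simp add: zero_fun_def)
  show sub: "fun_vs.subspace {v \<in> V. L v = 0}"
    using V(1) zero by (auto simp: fun_vs.subspace_def add scale)
  show "infinite_dimensional {v \<in> V. L v = 0}"
  proof (cases "\<forall>v\<in>V. L v = 0")
    case True
    then have "{v \<in> V. L v = 0} = V" by auto
    then show ?thesis using V(2) by simp
  next
    case False
    then obtain w where w: "w \<in> V" "L w \<noteq> 0" by blast
    show ?thesis
      unfolding infinite_dimensional_def
    proof
      assume "\<exists>B. finite B \<and> B \<subseteq> {v \<in> V. L v = 0} \<and> {v \<in> V. L v = 0} \<subseteq> fun_vs.span B"
      then obtain B where B: "finite B" "B \<subseteq> {v \<in> V. L v = 0}"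
        "{v \<in> V. L v = 0} \<subseteq> fun_vs.span B" by blast
      have "V \<subseteq> fun_vs.span (insert w B)"
      proof
        fix v assume v: "v \<in> V"
        define k where "k = L v / L w"
        have kw: "(\<lambda>x. k * w x) \<in> V" "(\<lambda>x. (-1) * (k * w x)) \<in> V"
          using fun_vs.subspace_scale[OF V(1)] w(1) by blast+
        have eq: "v - (\<lambda>x. k * w x) = v + (\<lambda>x. (-1) * (k * w x))"
          by (auto simp: fun_eq_iff)
        have "L (v - (\<lambda>x. k * w x)) = L v + (-1) * (k * L w)"
          unfolding eq using add[OF v kw(2)] scale[OF kw(1), of "-1"] scale[OF w(1), of k] by metis
        also have "\<dots> = 0" using w(2) by (simp add: k_def)
        finally have "v - (\<lambda>x. k * w x) \<in> {v \<in> V. L v = 0}"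
          using fun_vs.subspace_diff[OF V(1) v kw(1)] by simp
        then show "v \<in> fun_vs.span (insert w B)"
          using B(3) fun_vs.span_breakdown_eq[of v w B] by blast
      qed
      moreover have "insert w B \<subseteq> V" "finite (insert w B)" using B w by auto
      ultimately show False using V(2) unfolding infinite_dimensional_def by blast
    qed
  qed
qed

lemma infinite_dimensional_common_kernel:
  fixes L :: "nat \<Rightarrow> ('a \<Rightarrow> complex) \<Rightarrow> complex"
  assumes "fun_vs.subspace V" "infinite_dimensional V"
    and add: "\<And>i v w. v \<in> V \<Longrightarrow> w \<in> V \<Longrightarrow> L i (v + w) = L i v + L i w"
    and scale: "\<And>i a v. v \<in> V \<Longrightarrow> L i (\<lambda>x. a * v x) = a * L i v"
  obtains v where "v \<in> V" "v \<noteq> 0" "\<And>i. i < n \<Longrightarrow> L i v = 0"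
proof -
  let ?W = "\<lambda>n. {v \<in> V. \<forall>i<n. L i v = 0}"
  have W: "fun_vs.subspace (?W n) \<and> infinite_dimensional (?W n)" for n
  proof (induction n)
    case 0
    then show ?case using assms(1,2) by simp
  next
    case (Suc n)
    have "?W (Suc n) = {v \<in> ?W n. L n v = 0}" by (auto simp: less_Suc_eq)
    then show ?case
      using infinite_dimensional_kernel[of "?W n" "L n"] Suc add scale by simp
  qed
  have "\<not> ?W n \<subseteq> {0}"
  proof
    assume "?W n \<subseteq> {0}"
    then have "finite {} \<and> {} \<subseteq> ?W n \<and> ?W n \<subseteq> fun_vs.span {}" by simp
    then show False using W[of n] unfolding infinite_dimensional_def by blast
  qed
  then show thesis using that by blast
qed

section \<open>Leading terms of holomorphic functions\<close>

text \<open>For holomorphic \<open>g\<close> this says that \<open>g\<close> vanishes at \<open>c\<close> to order at least \<open>n\<close> and has \<open>n\<close>-th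
  Taylor coefficient \<open>\<alpha>\<close>, which may be zero. As a statement about a limit it passes to products
  and compositions without any manipulation of power series.\<close>

definition leading_term :: "(complex \<Rightarrow> complex) \<Rightarrow> complex \<Rightarrow> nat \<Rightarrow> complex \<Rightarrow> bool" where
  "leading_term g c n \<alpha> \<longleftrightarrow> ((\<lambda>z. g z / (z - c) ^ n) \<longlongrightarrow> \<alpha>) (at c)"

text \<open>The order is the index of the first derivative that does not vanish at \<open>c\<close>. That this
  derivative is nonzero is part of the conclusion because it bounds the order from below when some
  derivatives are known to vanish.\<close>

lemma leading_term_exists:
  assumes g: "g holomorphic_on S" "open S" "c \<in> S"
    and nz: "\<not> eventually (\<lambda>z. g z = 0) (nhds c)"
  obtains n \<alpha> where "leading_term g c n \<alpha>" "\<alpha> \<noteq> 0" "(deriv ^^ n) g c \<noteq> 0"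
proof -
  obtain r where r: "r > 0" "ball c r \<subseteq> S"
    using g(2,3) openE by blast
  have "\<exists>n. (deriv ^^ n) g c \<noteq> 0"
  proof (rule ccontr)
    assume "\<nexists>n. (deriv ^^ n) g c \<noteq> 0"
    then have "g w = 0" if "w \<in> ball c r" for w
      using holomorphic_fun_eq_0_on_connected[of g "ball c r" c w] that r
        holomorphic_on_subset[OF g(1) r(2)] by auto
    then have "eventually (\<lambda>z. g z = 0) (nhds c)"
      using r(1) eventually_nhds_in_open[of "ball c r" c] by (auto elim: eventually_mono)
    then show False using nz by simp
  qed
  define n where "n = (LEAST n. (deriv ^^ n) g c \<noteq> 0)"
  have n: "(deriv ^^ n) g c \<noteq> 0"
    unfolding n_def by (rule LeastI_ex) fact
  have less: "(deriv ^^ i) g c = 0" if "i < n" for i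
    using not_less_Least[OF that[unfolded n_def]] by simp
  show thesis
  proof (cases "n = 0")
    case True
    have "(g \<longlongrightarrow> g c) (at c)"
      using field_differentiable_imp_continuous_at[OF holomorphic_on_imp_differentiable_at[OF g]]
      by (rule isContD)
    then show thesis using that[of 0 "g c"] n True by (simp add: leading_term_def)
  next
    case False
    obtain k s where k: "0 < s" "k holomorphic_on ball c s"
      "\<And>w. w \<in> ball c s \<Longrightarrow> g w - g c = (w - c) ^ n * k w"
      "\<And>w. w \<in> ball c s \<Longrightarrow> k w \<noteq> 0"
      by (rule holomorphic_factor_order_of_zero[OF g _ n]) (use False less in blast)+
    have "g c = 0" using less[of 0] False by simp
    have "k field_differentiable at c"
      using k(1,2) by (intro holomorphic_on_imp_differentiable_at[of k "ball c s"]) auto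
    then have "(k \<longlongrightarrow> k c) (at c)"
      by (intro isContD field_differentiable_imp_continuous_at)
    moreover have "eventually (\<lambda>z. k z = g z / (z - c) ^ n) (at c)"
      using eventually_at_in_open[of "ball c s" c] k(1,3) \<open>g c = 0\<close>
      by (auto elim!: eventually_mono)
    ultimately have "leading_term g c n (k c)"
      unfolding leading_term_def by (rule Lim_transform_eventually)
    then show thesis using that k(1,4) n by auto
  qed
qed

lemma leading_term_eventually_nonzero:
  assumes "leading_term g c n \<alpha>" "\<alpha> \<noteq> 0"
  shows "eventually (\<lambda>z. g z \<noteq> 0) (at c)"
  using tendsto_imp_eventually_ne[OF assms(1)[unfolded leading_term_def] assms(2)]
  by (auto elim: eventually_mono)

text \<open>Since \<open>(F z - c) / (z - c)\<close> tends to \<open>l\<close>, the leading term \<open>\<alpha> w\<^sup>d\<close> of \<open>g\<close> becomes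
  \<open>\<alpha> l\<^sup>d (z - c)\<^sup>d\<close> after substitution of \<open>F\<close>. The condition \<open>l \<noteq> 0\<close> keeps \<open>F z\<close> away from \<open>c\<close> for
  \<open>z \<noteq> c\<close> near \<open>c\<close>, so that the punctured limit for \<open>g\<close> can be composed with \<open>F\<close>.\<close>

lemma leading_term_mult_compose:
  assumes v: "leading_term v c m b" and g: "leading_term g c d \<alpha>"
    and F: "(F has_field_derivative l) (at c)" "F c = c" "l \<noteq> 0"
  shows "leading_term (\<lambda>z. v z * g (F z)) c (d + m) (b * l ^ d * \<alpha>)"
proof -
  have quot: "((\<lambda>z. (F z - c) / (z - c)) \<longlongrightarrow> l) (at c)"
    using F(1,2) by (simp add: has_field_derivative_iff)
  have ne: "eventually (\<lambda>z. F z \<noteq> c) (at c)"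
    using tendsto_imp_eventually_ne[OF quot F(3)] by (auto elim: eventually_mono)
  have "(F \<longlongrightarrow> c) (at c)"
    using DERIV_isCont[OF F(1)] F(2) by (simp add: isCont_def)
  then have "filterlim F (at c) (at c)"
    using ne by (simp add: filterlim_at)
  then have "((\<lambda>z. g (F z) / (F z - c) ^ d) \<longlongrightarrow> \<alpha>) (at c)"
    using filterlim_compose g[unfolded leading_term_def] by blast
  with v have "((\<lambda>z. v z / (z - c) ^ m * ((F z - c) / (z - c)) ^ d * (g (F z) / (F z - c) ^ d))
      \<longlongrightarrow> b * l ^ d * \<alpha>) (at c)"
    unfolding leading_term_def by (intro tendsto_intros quot)
  moreover have "eventually (\<lambda>z. v z / (z - c) ^ m * ((F z - c) / (z - c)) ^ d *
      (g (F z) / (F z - c) ^ d) = v z * g (F z) / (z - c) ^ (d + m)) (at c)"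
    using ne by eventually_elim (simp add: power_divide power_add)
  ultimately show ?thesis
    unfolding leading_term_def by (rule Lim_transform_eventually)
qed

text \<open>The quotient \<open>g z / (z - c) ^ n\<close> extends holomorphically to \<open>c\<close> with value \<open>\<alpha>\<close> there, and it is
  bounded by \<open>B / R ^ n\<close> on the circle of radius \<open>R\<close>.\<close>

lemma leading_term_cauchy_estimate:
  assumes g: "g holomorphic_on S" "open S" "cball c R \<subseteq> S" "R > 0"
    and B: "\<And>z. z \<in> cball c R \<Longrightarrow> cmod (g z) \<le> B"
    and lead: "leading_term g c n \<alpha>"
  shows "cmod \<alpha> * R ^ n \<le> B"
proof -
  define q where "q = (\<lambda>z. if z = c then \<alpha> else g z / (z - c) ^ n)"
  have q: "q holomorphic_on S"
    unfolding q_def using lead[unfolded leading_term_def]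
    by (intro removable_singularity holomorphic_intros holomorphic_on_subset[OF g(1)] g(2)) auto
  \<comment> \<open>Cauchy's inequality for the derivative of order zero is the maximum principle at the centre.\<close>
  have "cmod ((deriv ^^ 0) q c) \<le> fact 0 * (B / R ^ n) / R ^ 0"
  proof (rule Cauchy_inequality)
    show "q holomorphic_on ball c R"
      by (rule holomorphic_on_subset[OF q]) (use g(3) in auto)
    show "continuous_on (cball c R) q"
      using q g(3) holomorphic_on_imp_continuous_on continuous_on_subset by blast
    show "cmod (q z) \<le> B / R ^ n" if "cmod (c - z) = R" for z
    proof -
      have "z \<noteq> c" "z \<in> cball c R" using that g(4) by (auto simp: dist_norm)
      then show ?thesis
        using B[of z] that g(4)
        by (auto simp: q_def norm_divide norm_power norm_minus_commute intro: divide_right_mono)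
    qed
  qed fact
  then show ?thesis using g(4) by (simp add: q_def field_simps)
qed

section \<open>Holomorphic functions in a chart\<close>

lemma chart_properties:
  assumes "is_chart X (U, \<phi>)"
  shows chart_openin: "openin X U" and chart_open: "open (\<phi> ` U)" and chart_inj: "inj_on \<phi> U"
    and chart_open_image: "\<And>T. openin X T \<Longrightarrow> open (\<phi> ` (U \<inter> T))"
    and chart_compactin: "\<And>K. compact K \<Longrightarrow> K \<subseteq> \<phi> ` U \<Longrightarrow> compactin X (inv_into U \<phi> ` K)"
proof -
  show U: "openin X U" and o: "open (\<phi> ` U)"
    using assms by (auto simp: is_chart_def)
  have hom: "homeomorphic_map (subtopology X U) (top_of_set (\<phi> ` U)) \<phi>"
    using assms by (auto simp: is_chart_def)
  have top: "topspace (subtopology X U) = U"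
    using openin_subset[OF U] by auto
  show inj: "inj_on \<phi> U"
    using homeomorphic_imp_injective_map[OF hom] top by simp
  show "open (\<phi> ` (U \<inter> T))" if "openin X T" for T
  proof -
    have "openin (subtopology X U) (U \<inter> T)" using that by (auto simp: openin_subtopology)
    then have "openin (top_of_set (\<phi> ` U)) (\<phi> ` (U \<inter> T))"
      using homeomorphic_imp_open_map[OF hom] by (auto simp: open_map_def)
    then show ?thesis using o openin_open_trans by blast
  qed
  show "compactin X (inv_into U \<phi> ` K)" if K: "compact K" "K \<subseteq> \<phi> ` U" for K
  proof -
    obtain \<psi> where \<psi>: "homeomorphic_maps (subtopology X U) (top_of_set (\<phi> ` U)) \<phi> \<psi>"
      using hom homeomorphic_map_maps by blast
    have cont: "continuous_map (top_of_set (\<phi> ` U)) (subtopology X U) \<psi>"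
      and inv: "\<And>x. x \<in> U \<Longrightarrow> \<psi> (\<phi> x) = x"
      using \<psi> top by (auto simp: homeomorphic_maps_def)
    have "inv_into U \<phi> ` K = \<psi> ` K"
      by (rule image_cong) (use K(2) inj inv in auto)
    moreover have "compactin (top_of_set (\<phi> ` U)) K"
      using K by (simp add: compactin_subtopology)
    then have "compactin (subtopology X U) (\<psi> ` K)"
      using cont image_compactin by blast
    ultimately show ?thesis by (simp add: compactin_subtopology)
  qed
qed

lemma (in riemann_surface) chart_around:
  assumes "p \<in> topspace X"
  obtains U \<phi> where "(U, \<phi>) \<in> A" "p \<in> U"
proof -
  have "p \<in> (\<Union>(U, \<phi>)\<in>A. U)" using assms by (simp add: cover)
  then show thesis using that by blast
qed

text \<open>This transports local properties of a function, such as having an isolated zero, from the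
  coordinate back to the surface.\<close>

lemma (in riemann_surface) punctured_neighbourhood_of_chart:
  assumes W: "(W, \<psi>) \<in> A" "x \<in> W"
    and ev: "eventually (\<lambda>z. P ((h \<circ> inv_into W \<psi>) z)) (at (\<psi> x))"
  obtains T where "openin X T" "x \<in> T" "\<And>y. y \<in> T \<Longrightarrow> y \<noteq> x \<Longrightarrow> P (h y)"
proof -
  have chart: "is_chart X (W, \<psi>)" using charts W by blast
  obtain S where S: "open S" "\<psi> x \<in> S" "\<And>z. z \<in> S - {\<psi> x} \<Longrightarrow> P ((h \<circ> inv_into W \<psi>) z)"
    using ev by (auto simp: eventually_at_topological)
  have hom: "homeomorphic_map (subtopology X W) (top_of_set (\<psi> ` W)) \<psi>"
    using chart by (auto simp: is_chart_def)
  have top: "topspace (subtopology X W) = W"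
    using openin_subset[OF chart_openin[OF chart]] by auto
  have "openin (subtopology X W) {y \<in> topspace (subtopology X W). \<psi> y \<in> \<psi> ` W \<inter> S}"
    using homeomorphic_imp_continuous_map[OF hom] openin_open_Int[OF S(1)]
    by (rule openin_continuous_map_preimage)
  then have "openin X {y \<in> W. \<psi> y \<in> \<psi> ` W \<inter> S}"
    unfolding top using chart_openin[OF chart] openin_trans_full by blast
  moreover have "P (h y)" if y: "y \<in> W" "\<psi> y \<in> S" "y \<noteq> x" for y
    using S(3)[of "\<psi> y"] y chart_inj[OF chart] W(2) by (auto dest: inj_onD)
  ultimately show thesis
    using W(2) S(2) by (intro that[of "{y \<in> W. \<psi> y \<in> \<psi> ` W \<inter> S}"]) auto
qed

text \<open>The identity theorem. The set \<open>Z\<close> of points near which \<open>h\<close> vanishes is open by definition. It is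
  also closed: at a point outside \<open>Z\<close> the function has a leading term, so it has no other zero
  nearby. Connectedness leaves only \<open>Z = {}\<close> or \<open>h = 0\<close>.\<close>

lemma (in riemann_surface) hol_funs_identity:
  assumes h: "h \<in> hol_funs X A" "h \<noteq> 0" and c: "(U, \<phi>) \<in> A" "p \<in> U"
  shows "\<not> eventually (\<lambda>z. (h \<circ> inv_into U \<phi>) z = 0) (nhds (\<phi> p))"
proof
  define Z where "Z = {x. \<exists>T. openin X T \<and> x \<in> T \<and> (\<forall>y\<in>T. h y = 0)}"
  have vanishing: "x \<in> Z" if W: "(W, \<psi>) \<in> A" "x \<in> W"
    and ev: "eventually (\<lambda>z. (h \<circ> inv_into W \<psi>) z = 0) (nhds (\<psi> x))" for W \<psi> x
  proof -
    have "h x = 0"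
      using eventually_nhds_x_imp_x[OF ev] chart_inj[OF charts[OF W(1)]] W(2) by simp
    moreover have "eventually (\<lambda>z. (h \<circ> inv_into W \<psi>) z = 0) (at (\<psi> x))"
      unfolding eventually_at_filter using ev by (rule eventually_mono) simp
    then obtain T where "openin X T" "x \<in> T" "\<And>y. y \<in> T \<Longrightarrow> y \<noteq> x \<Longrightarrow> h y = 0"
      using punctured_neighbourhood_of_chart[OF W, of "\<lambda>w. w = 0" h] by metis
    ultimately show ?thesis unfolding Z_def by (intro CollectI exI[of _ T]) auto
  qed
  have "openin X Z"
    by (subst openin_subopen) (auto simp: Z_def)
  moreover have "openin X (topspace X - Z)"
  proof (subst openin_subopen, intro ballI)
    fix x assume x: "x \<in> topspace X - Z"
    then obtain W \<psi> where W: "(W, \<psi>) \<in> A" "x \<in> W"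
      using chart_around by blast
    have chart: "is_chart X (W, \<psi>)" using charts W by blast
    have hol: "(h \<circ> inv_into W \<psi>) holomorphic_on \<psi> ` W"
      using h(1) W by (auto simp: hol_funs_def)
    have "\<not> eventually (\<lambda>z. (h \<circ> inv_into W \<psi>) z = 0) (nhds (\<psi> x))"
      using vanishing[OF W] x by blast
    then obtain n \<alpha> where "leading_term (h \<circ> inv_into W \<psi>) (\<psi> x) n \<alpha>" "\<alpha> \<noteq> 0"
      using leading_term_exists[OF hol chart_open[OF chart]] W(2) by blast
    then have "eventually (\<lambda>z. (h \<circ> inv_into W \<psi>) z \<noteq> 0) (at (\<psi> x))"
      by (rule leading_term_eventually_nonzero)
    then obtain T where T: "openin X T" "x \<in> T" "\<And>y. y \<in> T \<Longrightarrow> y \<noteq> x \<Longrightarrow> h y \<noteq> 0"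
      using punctured_neighbourhood_of_chart[OF W, of "\<lambda>w. w \<noteq> 0" h] by metis
    have "h y = 0" if "y \<in> Z" for y
      using that unfolding Z_def by blast
    then have "T \<inter> Z = {}"
      using T(3) x by blast
    then show "\<exists>T. openin X T \<and> x \<in> T \<and> T \<subseteq> topspace X - Z"
      using T openin_subset by blast
  qed
  ultimately have clopen: "openin X Z" "closedin X Z"
    using openin_subset by (auto simp: closedin_def)
  assume ev: "eventually (\<lambda>z. (h \<circ> inv_into U \<phi>) z = 0) (nhds (\<phi> p))"
  have "p \<in> Z" by (rule vanishing[OF c ev])
  then have "Z = topspace X"
    using clopen connected connected_space_clopen_in by blast
  then have "h x = 0" for x
    using h(1) by (cases "x \<in> topspace X") (auto simp: hol_funs_def Z_def)
  then show False using h(2) by (auto simp: fun_eq_iff)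
qed

section \<open>Spaces of holomorphic functions with continuous inclusion\<close>

text \<open>Continuity of the inclusion at \<open>0\<close> provides a quasi-norm ball whose elements are bounded by \<open>1\<close>
  on \<open>K\<close>, and homogeneity of the quasi-norm turns this into a linear bound.\<close>

lemma evaluation_bound:
  assumes V: "fun_vs.subspace V" "quasi_norm_on V N" "V \<subseteq> hol_funs X A"
    and cont: "continuous_map (quasi_norm_topology V N) (hol_topology X A) (\<lambda>h. h)"
    and K: "compactin X K"
  obtains M where "M > 0" "\<And>h x. h \<in> V \<Longrightarrow> x \<in> K \<Longrightarrow> cmod (h x) \<le> M * N h"
proof -
  \<comment> \<open>The uniform gap \<open>\<delta>\<close> makes \<open>W\<close> visibly open: half of it survives a perturbation of size \<open>\<delta> / 2\<close>.\<close>
  define W where "W = {h \<in> hol_funs X A. \<exists>\<delta>>0. \<forall>x\<in>K. cmod (h x) \<le> 1 - \<delta>}"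
  have topV: "V \<subseteq> topspace (quasi_norm_topology V N)"
    by (rule openin_subset) (auto simp: openin_quasi_norm_topology intro: exI[of _ 1])
  have "openin (hol_topology X A) W"
    unfolding openin_hol_topology
  proof (intro conjI ballI)
    show "W \<subseteq> hol_funs X A" by (auto simp: W_def)
    fix h assume "h \<in> W"
    then obtain \<delta> where \<delta>: "\<delta> > 0" "\<And>x. x \<in> K \<Longrightarrow> cmod (h x) \<le> 1 - \<delta>"
      by (auto simp: W_def)
    have "g \<in> W" if g: "g \<in> hol_funs X A" "\<forall>x\<in>K. cmod (g x - h x) < \<delta> / 2" for g
    proof -
      have "cmod (g x) \<le> 1 - \<delta> / 2" if "x \<in> K" for x
        using g(2) \<delta>(2)[OF that] that norm_triangle_sub[of "g x" "h x"] by fastforce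
      then show ?thesis using g(1) \<delta>(1) by (auto simp: W_def intro!: exI[of _ "\<delta> / 2"])
    qed
    then show "\<exists>K \<epsilon>. compactin X K \<and> \<epsilon> > 0 \<and>
        (\<forall>g\<in>hol_funs X A. (\<forall>x\<in>K. cmod (g x - h x) < \<epsilon>) \<longrightarrow> g \<in> W)"
      using K \<delta>(1) by (intro exI[of _ K] exI[of _ "\<delta> / 2"]) auto
  qed
  then have "openin (quasi_norm_topology V N)
      {h \<in> topspace (quasi_norm_topology V N). h \<in> W}"
    using cont openin_continuous_map_preimage by blast
  moreover have "0 \<in> {h \<in> topspace (quasi_norm_topology V N). h \<in> W}"
    using fun_vs.subspace_0[OF V(1)] topV V(3) by (auto simp: W_def intro!: exI[of _ 1])
  ultimately obtain \<epsilon> where "\<epsilon> > 0"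
    "\<forall>w\<in>V. N (w - 0) < \<epsilon> \<longrightarrow> w \<in> {h \<in> topspace (quasi_norm_topology V N). h \<in> W}"
    unfolding openin_quasi_norm_topology by blast
  then have \<epsilon>: "\<epsilon> > 0" "\<And>w. w \<in> V \<Longrightarrow> N w < \<epsilon> \<Longrightarrow> w \<in> W" by simp_all
  have pos: "\<And>v. v \<in> V \<Longrightarrow> N v \<ge> 0"
    and scale: "\<And>a v. v \<in> V \<Longrightarrow> N (\<lambda>x. a * v x) = cmod a * N v"
    and def: "\<And>v. v \<in> V \<Longrightarrow> N v = 0 \<Longrightarrow> v = 0"
    using V(2) by (auto simp: quasi_norm_on_def)
  have "cmod (h x) \<le> 2 / \<epsilon> * N h" if h: "h \<in> V" "x \<in> K" for h x
  proof (cases "N h = 0")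
    case True
    then show ?thesis using def[OF h(1)] by simp
  next
    case False
    then have Nh: "N h > 0" using pos[OF h(1)] by simp
    \<comment> \<open>A factor that scales \<open>h\<close> to quasi-norm \<open>\<epsilon> / 2\<close>, hence into the ball found above.\<close>
    define a where "a = complex_of_real (\<epsilon> / (2 * N h))"
    have a: "cmod a = \<epsilon> / (2 * N h)" using Nh \<epsilon>(1) by (simp add: a_def norm_divide norm_mult)
    have "N (\<lambda>x. a * h x) < \<epsilon>"
      using scale[OF h(1), of a] a Nh \<epsilon>(1) by simp
    then have "(\<lambda>x. a * h x) \<in> W"
      using \<epsilon>(2) fun_vs.subspace_scale[OF V(1) h(1)] by blast
    then have "cmod (a * h x) \<le> 1" using h(2) by (force simp: W_def)
    then show ?thesis using a Nh \<epsilon>(1) by (simp add: norm_mult field_simps)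
  qed
  then show thesis using that[of "2 / \<epsilon>"] \<epsilon>(1) by simp
qed

text \<open>The derivatives of order less than \<open>n\<close> at \<open>p\<close>, taken in the chart, are finitely many linear
  functionals, so they have a common zero \<open>h \<noteq> 0\<close> in \<open>V\<close>. By the identity theorem \<open>h\<close> has a leading
  term at \<open>p\<close>.\<close>

lemma (in riemann_surface) element_of_high_order:
  assumes V: "fun_vs.subspace V" "infinite_dimensional V" "V \<subseteq> hol_funs X A"
    and c: "(U, \<phi>) \<in> A" "p \<in> U"
  obtains h d \<alpha> where "h \<in> V" "d \<ge> n" "\<alpha> \<noteq> 0" "leading_term (h \<circ> inv_into U \<phi>) (\<phi> p) d \<alpha>"
proof -
  have chart: "is_chart X (U, \<phi>)" using charts c by blast
  have hol: "(h \<circ> inv_into U \<phi>) holomorphic_on \<phi> ` U" if "h \<in> V" for h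
    using V(3) that c by (auto simp: hol_funs_def)
  have p: "\<phi> p \<in> \<phi> ` U" using c by simp
  define L where "L = (\<lambda>i h. (deriv ^^ i) (h \<circ> inv_into U \<phi>) (\<phi> p))"
  have "L i (v + w) = L i v + L i w" if "v \<in> V" "w \<in> V" for i v w
    using higher_deriv_add[OF hol[OF that(1)] hol[OF that(2)] chart_open[OF chart] p]
    by (simp add: L_def o_def)
  moreover have "L i (\<lambda>x. a * v x) = a * L i v" if "v \<in> V" for i a v
    using higher_deriv_cmult[OF hol[OF that] p chart_open[OF chart]]
    by (simp add: L_def o_def)
  ultimately obtain h where h: "h \<in> V" "h \<noteq> 0" "\<And>i. i < n \<Longrightarrow> L i h = 0"
    using infinite_dimensional_common_kernel[OF V(1,2), of L n] by blast
  obtain d \<alpha> where d: "leading_term (h \<circ> inv_into U \<phi>) (\<phi> p) d \<alpha>" "\<alpha> \<noteq> 0"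
      "(deriv ^^ d) (h \<circ> inv_into U \<phi>) (\<phi> p) \<noteq> 0"
    using leading_term_exists[OF hol[OF h(1)] chart_open[OF chart] p]
      hol_funs_identity[OF _ h(2) c] h(1) V(3) by blast
  then have "d \<ge> n" using h(3)[of d] by (cases "d < n") (auto simp: L_def)
  then show thesis using that h(1) d by blast
qed

section \<open>Growth of the leading terms under iteration\<close>

text \<open>In the chart, \<open>wcomp u f h\<close> is \<open>u z * h (F z)\<close> with \<open>F\<close> the coordinate expression of \<open>f\<close>, but only
  where \<open>f\<close> does not leave the chart domain. Such points form a neighbourhood of the fixed point,
  which is enough for the limit.\<close>

lemma (in riemann_surface) wcomp_leading_term:
  assumes f: "hol_self_map X A f" "f p = p" and c: "(U, \<phi>) \<in> A" "p \<in> U"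
    and deriv: "fixpoint_deriv A f p \<noteq> 0"
    and u: "leading_term (u \<circ> inv_into U \<phi>) (\<phi> p) m b"
    and h: "leading_term (h \<circ> inv_into U \<phi>) (\<phi> p) d \<alpha>"
  shows "leading_term (wcomp u f h \<circ> inv_into U \<phi>) (\<phi> p) (d + m)
           (b * fixpoint_deriv A f p ^ d * \<alpha>)"
proof -
  have chart: "is_chart X (U, \<phi>)" using charts c by blast
  define F where "F = \<phi> \<circ> f \<circ> inv_into U \<phi>"
  define T where "T = U \<inter> {x \<in> topspace X. f x \<in> U}"
  have cont: "continuous_map X X f"
    and hol: "\<forall>(U, \<phi>)\<in>A. \<forall>(W, \<psi>)\<in>A. (\<psi> \<circ> f \<circ> inv_into U \<phi>) holomorphic_on \<phi> ` (U \<inter> f -` W)"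
    using f(1) unfolding hol_self_map_def by blast+
  have "openin X {x \<in> topspace X. f x \<in> U}"
    using cont chart_openin[OF chart] by (rule openin_continuous_map_preimage)
  then have T: "open (\<phi> ` T)" unfolding T_def by (rule chart_open_image[OF chart])
  have pT: "\<phi> p \<in> \<phi> ` T"
    using c f(2) openin_subset[OF chart_openin[OF chart]] by (auto simp: T_def)
  have "F holomorphic_on \<phi> ` (U \<inter> f -` U)"
    unfolding F_def using bspec[OF bspec[OF hol c(1), simplified] c(1)] by simp
  then have "F holomorphic_on \<phi> ` T"
    by (rule holomorphic_on_subset) (auto simp: T_def)
  then have "(F has_field_derivative deriv F (\<phi> p)) (at (\<phi> p))"
    using T pT by (rule holomorphic_derivI)
  then have F: "(F has_field_derivative fixpoint_deriv A f p) (at (\<phi> p))"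
    unfolding fixpoint_deriv_eq[OF riemann_surface_axioms f(1) c f(2)] F_def .
  have Fp: "F (\<phi> p) = \<phi> p" using chart_inj[OF chart] c f(2) by (simp add: F_def)
  have eq: "(u \<circ> inv_into U \<phi>) z * (h \<circ> inv_into U \<phi>) (F z) = (wcomp u f h \<circ> inv_into U \<phi>) z"
    if z: "z \<in> \<phi> ` T" for z
  proof -
    obtain x where "z = \<phi> x" "x \<in> U" "f x \<in> U" using z unfolding T_def by blast
    then show ?thesis using chart_inj[OF chart] by (simp add: F_def wcomp_def)
  qed
  have "eventually (\<lambda>z. (u \<circ> inv_into U \<phi>) z * (h \<circ> inv_into U \<phi>) (F z) / (z - \<phi> p) ^ (d + m) =
      (wcomp u f h \<circ> inv_into U \<phi>) z / (z - \<phi> p) ^ (d + m)) (at (\<phi> p))"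
    using eventually_at_in_open'[OF T pT] by eventually_elim (simp only: eq)
  with leading_term_mult_compose[OF u h F Fp deriv] show ?thesis
    unfolding leading_term_def by (rule Lim_transform_eventually)
qed

theorem theorem1p7:
  fixes X :: "'a topology" and A :: "'a chart set"
    and V :: "('a \<Rightarrow> complex) set" and N :: "('a \<Rightarrow> complex) \<Rightarrow> real"
    and f :: "'a \<Rightarrow> 'a" and u :: "'a \<Rightarrow> complex"
  assumes "riemann_surface X A"
    and "quasi_banach_on V N"
    and "infinite_dimensional V"
    and "V \<subseteq> hol_funs X A"
    and "continuous_map (quasi_norm_topology V N) (hol_topology X A) (\<lambda>h. h)"
    and "hol_self_map X A f"
    and "u \<in> hol_funs X A - {0}"
    and "wcomp_bounded_on V N u f"
  shows "\<forall>p \<in> topspace X. f p = p \<longrightarrow> cmod (fixpoint_deriv A f p) \<le> 1"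
proof (intro ballI impI, rule ccontr)
  interpret riemann_surface X A by fact
  fix p assume p: "p \<in> topspace X" "f p = p"
  assume "\<not> cmod (fixpoint_deriv A f p) \<le> 1"
  define l where "l = fixpoint_deriv A f p"
  have l: "cmod l > 1" "fixpoint_deriv A f p \<noteq> 0"
    using \<open>\<not> cmod (fixpoint_deriv A f p) \<le> 1\<close> by (auto simp: l_def)
  have V: "fun_vs.subspace V" "quasi_norm_on V N"
    using assms(2) by (auto simp: quasi_banach_on_def)
  obtain U \<phi> where c: "(U, \<phi>) \<in> A" "p \<in> U"
    using chart_around[OF p(1)] .
  have chart: "is_chart X (U, \<phi>)" using charts c by blast
  have hol: "(h \<circ> inv_into U \<phi>) holomorphic_on \<phi> ` U" if "h \<in> hol_funs X A" for h
    using that c by (auto simp: hol_funs_def)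
  have pU: "\<phi> p \<in> \<phi> ` U" using c by simp
  obtain R where R: "R > 0" "cball (\<phi> p) R \<subseteq> \<phi> ` U"
    using chart_open[OF chart] pU open_contains_cball by blast
  obtain M where M: "M > 0"
    "\<And>h x. h \<in> V \<Longrightarrow> x \<in> inv_into U \<phi> ` cball (\<phi> p) R \<Longrightarrow> cmod (h x) \<le> M * N h"
    using evaluation_bound[OF V assms(4,5) chart_compactin[OF chart compact_cball R(2)]] by blast
  have coeff: "cmod \<alpha> * R ^ k \<le> M * N h"
    if "h \<in> V" "leading_term (h \<circ> inv_into U \<phi>) (\<phi> p) k \<alpha>" for h k \<alpha>
    using leading_term_cauchy_estimate[OF hol chart_open[OF chart] R(2,1) _ that(2)] M(2) that(1)
      assms(4) by auto
  obtain m b where u: "leading_term (u \<circ> inv_into U \<phi>) (\<phi> p) m b" "b \<noteq> 0"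
  proof -
    have u: "u \<in> hol_funs X A" "u \<noteq> 0" using assms(7) by auto
    show thesis
      using leading_term_exists[OF hol[OF u(1)] chart_open[OF chart] pU hol_funs_identity[OF u c]]
        that by blast
  qed
  have domain: "V \<subseteq> wcomp_domain V u f"
    using assms(8) unfolding wcomp_bounded_on_def by blast
  obtain C0 where C0: "\<And>h. h \<in> V \<Longrightarrow> N (wcomp u f h) \<le> C0 * N h"
    using assms(8) unfolding wcomp_bounded_on_def by blast
  \<comment> \<open>Division by the operator bound \<open>C\<close> below needs it to be positive.\<close>
  define C where "C = max C0 1"
  have C: "C > 0" by (simp add: C_def)
  have VN: "wcomp u f h \<in> V" "N (wcomp u f h) \<le> C * N h" if "h \<in> V" for h
  proof -
    show "wcomp u f h \<in> V"
      using domain that unfolding wcomp_domain_def by blast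
    have "N h \<ge> 0" using V(2) that by (auto simp: quasi_norm_on_def)
    then have "C0 * N h \<le> C * N h" by (intro mult_right_mono) (auto simp: C_def)
    then show "N (wcomp u f h) \<le> C * N h" using C0[OF that] by linarith
  qed
  \<comment> \<open>The order \<open>n\<close> is chosen so that the growth factor \<open>q\<close> below exceeds \<open>1\<close>.\<close>
  obtain n where n: "cmod l ^ n > C / (cmod b * R ^ m)"
    using real_arch_pow[OF l(1)] by blast
  obtain h d \<alpha> where h: "h \<in> V" "d \<ge> n" "\<alpha> \<noteq> 0"
      "leading_term (h \<circ> inv_into U \<phi>) (\<phi> p) d \<alpha>"
    using element_of_high_order[OF V(1) assms(3,4) c] by blast
  define q where "q = cmod b * cmod l ^ d * R ^ m / C"
  have "C / (cmod b * R ^ m) < cmod l ^ d"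
    using n power_increasing[OF h(2), of "cmod l"] l(1) by linarith
  then have q: "q > 1"
    using u(2) R(1) C by (simp add: q_def field_simps)
  \<comment> \<open>The function \<open>g\<close> is the \<open>k\<close>-th iterate of the operator at \<open>h\<close>. Its exact leading coefficient has
    further factors \<open>l ^ (i * m)\<close>, which have modulus at least \<open>1\<close> and are dropped.\<close>
  have iter: "\<exists>g \<beta>. g \<in> V \<and> N g \<le> C ^ k * N h \<and>
      leading_term (g \<circ> inv_into U \<phi>) (\<phi> p) (d + k * m) \<beta> \<and>
      cmod \<alpha> * (cmod b * cmod l ^ d) ^ k \<le> cmod \<beta>" for k
  proof (induction k)
    case 0
    have "leading_term (h \<circ> inv_into U \<phi>) (\<phi> p) (d + 0 * m) \<alpha>"
      using h(4) unfolding mult_0 add_0_right .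
    then show ?case
      using h(1) by (intro exI[of _ h] exI[of _ \<alpha>] conjI) (assumption | simp)+
  next
    case (Suc k)
    then obtain g \<beta> where g: "g \<in> V" "N g \<le> C ^ k * N h"
      "leading_term (g \<circ> inv_into U \<phi>) (\<phi> p) (d + k * m) \<beta>"
      "cmod \<alpha> * (cmod b * cmod l ^ d) ^ k \<le> cmod \<beta>" by blast
    have "N (wcomp u f g) \<le> C * N g" by (rule VN) fact
    also have "\<dots> \<le> C * (C ^ k * N h)" using g(2) C by simp
    finally have 1: "N (wcomp u f g) \<le> C ^ Suc k * N h" by (simp add: mult.assoc)
    have 2: "leading_term (wcomp u f g \<circ> inv_into U \<phi>) (\<phi> p) (d + Suc k * m)
        (b * l ^ (d + k * m) * \<beta>)"
      using wcomp_leading_term[OF assms(6) p(2) c l(2) u(1) g(3)] by (simp add: l_def ac_simps)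
    have "cmod l ^ d \<le> cmod l ^ (d + k * m)"
      using l(1) by (intro power_increasing) auto
    then have "(cmod b * cmod l ^ d) * (cmod \<alpha> * (cmod b * cmod l ^ d) ^ k)
        \<le> (cmod b * cmod l ^ (d + k * m)) * cmod \<beta>"
      using g(4) by (intro mult_mono) auto
    then have 3: "cmod \<alpha> * (cmod b * cmod l ^ d) ^ Suc k \<le> cmod (b * l ^ (d + k * m) * \<beta>)"
      by (simp add: norm_mult norm_power ac_simps)
    show ?case using VN(1)[OF g(1)] 1 2 3 by blast
  qed
  have bounded: "cmod \<alpha> * R ^ d * q ^ k \<le> M * N h" for k
  proof -
    obtain g \<beta> where g: "g \<in> V" "N g \<le> C ^ k * N h"
      "leading_term (g \<circ> inv_into U \<phi>) (\<phi> p) (d + k * m) \<beta>"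
      "cmod \<alpha> * (cmod b * cmod l ^ d) ^ k \<le> cmod \<beta>" using iter by blast
    have "cmod \<alpha> * R ^ d * q ^ k * C ^ k = cmod \<alpha> * (cmod b * cmod l ^ d) ^ k * R ^ (d + k * m)"
      using C by (simp add: q_def power_add power_mult power_mult_distrib power_divide
          mult.commute[of k m])
    also have "\<dots> \<le> cmod \<beta> * R ^ (d + k * m)"
      using g(4) R(1) by (intro mult_right_mono) auto
    also have "\<dots> \<le> M * N g" by (rule coeff) fact+
    also have "\<dots> \<le> M * (C ^ k * N h)" using g(2) M(1) by simp
    finally have "cmod \<alpha> * R ^ d * q ^ k * C ^ k \<le> M * N h * C ^ k" by (simp add: ac_simps)
    then show ?thesis using C by simp
  qed
  obtain k where "q ^ k > M * N h / (cmod \<alpha> * R ^ d)"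
    using real_arch_pow[OF q] by blast
  moreover have "cmod \<alpha> * R ^ d > 0" using h(3) R(1) by simp
  ultimately have "cmod \<alpha> * R ^ d * q ^ k > M * N h" by (simp add: field_simps)
  then show False using bounded[of k] by linarith
qed

end
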